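(* Every finite free $\mathbb{Z}_2$-simplicial complex $K$ is isomorphic to $S(A_K)$ for some partial sign matrix $A_K$ (a matrix with entries in $\{-1,1,*\}$).
   Context: A free $\mathbb{Z}_2$-simplicial complex is an abstract simplicial complex $K$ together with a simplicial map $\tau:K\to K$ with $\tau^2=\mathrm{id}$ and $\tau(\sigma)\ne\sigma$ for every nonempty simplex $\sigma\in K$. Two simplicial complexes $K,L$ are isomorphic if there is a bijection $\varphi:V(K)\to V(L)$ of vertex sets with $\sigma\in K\iff\varphi(\sigma)\in L$. Sign complex. For $A\in\{-1,1,*\}^{M\times N}$ and each row $r$ of $A$, let $\sigma_r^+=\{i^+: r_i=+1\}\cup\{i^-: r_i=-1\}$ and $\sigma_r^-=\{i^-: r_i=+1\}\cup\{i^+: r_i=-1\}$, subsets of $\{1^+,1^-,\dots,N^+,N^-\}$. The sign complex $S(A)$ is the abstract simplicial complex whose simplices are all subsets of $\sigma_r^+$ or $\sigma_r^-$ over all rows $r$, with the free $\mathbb{Z}_2$-action exchanging $i^+$ and $i^-$. *)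

theory Defs
  imports "Jordan_Normal_Form.Matrix"
begin

definition simplicial_complex :: "'a set set \<Rightarrow> bool" where
  "simplicial_complex K \<longleftrightarrow>
     (\<forall>\<sigma>\<in>K. finite \<sigma>) \<and> (\<forall>\<sigma>\<in>K. \<forall>\<rho>. \<rho> \<subseteq> \<sigma> \<longrightarrow> \<rho> \<in> K)"

abbreviation vertex_set :: "'a set set \<Rightarrow> 'a set" where
  "vertex_set K \<equiv> \<Union>K"

definition simplicial_map :: "'a set set \<Rightarrow> 'b set set \<Rightarrow> ('a \<Rightarrow> 'b) \<Rightarrow> bool" where
  "simplicial_map K L f \<longleftrightarrow> (\<forall>\<sigma>\<in>K. f ` \<sigma> \<in> L)"

text \<open>Only the values of \<open>\<tau>\<close> on the vertices of \<open>K\<close> matter.\<close>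

definition free_Z2_complex :: "'a set set \<Rightarrow> ('a \<Rightarrow> 'a) \<Rightarrow> bool" where
  "free_Z2_complex K \<tau> \<longleftrightarrow>
     simplicial_complex K \<and> simplicial_map K K \<tau> \<and>
     (\<forall>v\<in>vertex_set K. \<tau> (\<tau> v) = v) \<and>
     (\<forall>\<sigma>\<in>K. \<sigma> \<noteq> {} \<longrightarrow> \<tau> ` \<sigma> \<noteq> \<sigma>)"

definition isomorphic_complexes :: "'a set set \<Rightarrow> 'b set set \<Rightarrow> bool" where
  "isomorphic_complexes K L \<longleftrightarrow>
     (\<exists>\<phi>. bij_betw \<phi> (vertex_set K) (vertex_set L) \<and>
          (\<forall>\<sigma>. \<sigma> \<subseteq> vertex_set K \<longrightarrow> (\<sigma> \<in> K \<longleftrightarrow> \<phi> ` \<sigma> \<in> L)))"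

datatype sign_entry = Minus_One | Plus_One | Star

type_synonym partial_sign_matrix = "sign_entry mat"

text \<open>\<open>Pos i\<close> and \<open>Neg i\<close> stand for \<open>i\<close> with superscript plus and minus; the columns
  are numbered from 0, as usual for matrices in this library.\<close>

datatype signed_index = Pos nat | Neg nat

fun flip_sign :: "signed_index \<Rightarrow> signed_index" where
  "flip_sign (Pos i) = Neg i"
| "flip_sign (Neg i) = Pos i"

definition row_simplex_plus :: "sign_entry vec \<Rightarrow> signed_index set" where
  "row_simplex_plus r =
     {Pos i |i. i < dim_vec r \<and> r $ i = Plus_One} \<union> {Neg i |i. i < dim_vec r \<and> r $ i = Minus_One}"

definition row_simplex_minus :: "sign_entry vec \<Rightarrow> signed_index set" where
  "row_simplex_minus r =
     {Neg i |i. i < dim_vec r \<and> r $ i = Plus_One} \<union> {Pos i |i. i < dim_vec r \<and> r $ i = Minus_One}"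

definition sign_complex :: "partial_sign_matrix \<Rightarrow> signed_index set set" where
  "sign_complex A =
     {\<sigma>. \<exists>k < dim_row A. \<sigma> \<subseteq> row_simplex_plus (row A k) \<or> \<sigma> \<subseteq> row_simplex_minus (row A k)}"

lemma finite_row_simplex:
  "finite (row_simplex_plus r)" "finite (row_simplex_minus r)"
  by (auto simp: row_simplex_plus_def row_simplex_minus_def)

lemma flip_sign_flip_sign [simp]: "flip_sign (flip_sign x) = x"
  by (cases x) auto

lemma flip_sign_row_simplex:
  "x \<in> row_simplex_plus r \<Longrightarrow> flip_sign x \<in> row_simplex_minus r"
  "x \<in> row_simplex_minus r \<Longrightarrow> flip_sign x \<in> row_simplex_plus r"
  by (auto simp: row_simplex_plus_def row_simplex_minus_def)

lemma row_simplex_disjoint: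
  "row_simplex_plus r \<inter> row_simplex_minus r = {}"
  by (auto simp: row_simplex_plus_def row_simplex_minus_def)

lemma free_Z2_complex_sign_complex: "free_Z2_complex (sign_complex A) flip_sign"
proof -
  have "simplicial_complex (sign_complex A)"
    unfolding simplicial_complex_def sign_complex_def
    by (auto intro: finite_subset[OF _ finite_row_simplex(1)] finite_subset[OF _ finite_row_simplex(2)])
  moreover have "simplicial_map (sign_complex A) (sign_complex A) flip_sign"
    unfolding simplicial_map_def sign_complex_def
    by (auto 0 3 simp: image_subset_iff dest: flip_sign_row_simplex)
  moreover have "flip_sign ` \<sigma> \<noteq> \<sigma>" if mem: "\<sigma> \<in> sign_complex A" and ne: "\<sigma> \<noteq> {}" for \<sigma>
  proof
    assume eq: "flip_sign ` \<sigma> = \<sigma>"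
    obtain x where x: "x \<in> \<sigma>" using ne by blast
    with eq have fx: "flip_sign x \<in> \<sigma>" by blast
    obtain k where "\<sigma> \<subseteq> row_simplex_plus (row A k) \<or> \<sigma> \<subseteq> row_simplex_minus (row A k)"
      using mem unfolding sign_complex_def by blast
    with x fx show False
      using flip_sign_row_simplex[of x "row A k"] row_simplex_disjoint[of "row A k"] by blast
  qed
  ultimately show ?thesis
    unfolding free_Z2_complex_def by simp
qed

end

theory Submission
  imports Defs
begin

text \<open>
  A sign matrix can realise \<open>K\<close> because a free involution \<open>\<tau>\<close> makes no simplex contain two
  vertices of one orbit: an edge \<open>{v, \<tau> v}\<close> would be mapped to itself. Label the two vertices of
  each orbit by \<open>Pos i\<close> and \<open>Neg i\<close>, with one index \<open>i\<close> per orbit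
  (\<open>ex_equivariant_labelling\<close>). A simplex then becomes a set of signed indices without opposite
  elements, and such a set is exactly what one row of signs and stars records: the row describes
  the simplex together with its image under \<open>\<tau>\<close> (\<open>row_simplex_sign_row\<close>). The matrix with one
  row for every simplex of \<open>K\<close> therefore generates the faces of all \<open>\<sigma>\<close> and \<open>\<tau> \<sigma>\<close>, which are the
  simplices of \<open>K\<close> again, since \<open>K\<close> is closed under subsets and under \<open>\<tau>\<close>.
\<close>

fun index_of :: "signed_index \<Rightarrow> nat" where
  "index_of (Pos i) = i"
| "index_of (Neg i) = i"

definition sign_row :: "nat \<Rightarrow> signed_index set \<Rightarrow> sign_entry vec" where
  "sign_row N s =
     vec N (\<lambda>i. if Pos i \<in> s then Plus_One else if Neg i \<in> s then Minus_One else Star)"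

text \<open>The disjointness hypothesis is what lets one entry per column suffice: it excludes that
  \<open>s\<close> contains both \<open>Pos i\<close> and \<open>Neg i\<close>.\<close>

lemma row_simplex_sign_row:
  assumes bound: "\<And>x. x \<in> s \<Longrightarrow> index_of x < N"
    and opp: "s \<inter> flip_sign ` s = {}"
  shows "row_simplex_plus (sign_row N s) = s"
    and "row_simplex_minus (sign_row N s) = flip_sign ` s"
proof -
  have ex: "\<not> (Pos i \<in> s \<and> Neg i \<in> s)" for i
    using opp by force
  have pos: "sign_row N s $ i = Plus_One \<longleftrightarrow> Pos i \<in> s" if "i < N" for i
    using that by (simp add: sign_row_def)
  have neg: "sign_row N s $ i = Minus_One \<longleftrightarrow> Neg i \<in> s" if "i < N" for i
    using that ex[of i] by (simp add: sign_row_def)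
  have dim: "dim_vec (sign_row N s) = N"
    by (simp add: sign_row_def)
  have mem_flip: "x \<in> flip_sign ` s \<longleftrightarrow> flip_sign x \<in> s" for x
    by (metis flip_sign_flip_sign image_iff)
  have "x \<in> row_simplex_plus (sign_row N s) \<longleftrightarrow> x \<in> s" for x
    using bound[of x] pos neg by (cases x) (auto simp: row_simplex_plus_def dim)
  then show "row_simplex_plus (sign_row N s) = s"
    by blast
  have "x \<in> row_simplex_minus (sign_row N s) \<longleftrightarrow> flip_sign x \<in> s" for x
    using bound[of "flip_sign x"] pos neg by (cases x) (auto simp: row_simplex_minus_def dim)
  then show "row_simplex_minus (sign_row N s) = flip_sign ` s"
    using mem_flip by blast
qed

lemma ex_sign_matrix_generated_by:
  assumes fin: "finite F"
    and bound: "\<And>s x. s \<in> F \<Longrightarrow> x \<in> s \<Longrightarrow> index_of x < N"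
    and opp: "\<And>s. s \<in> F \<Longrightarrow> s \<inter> flip_sign ` s = {}"
  obtains A where "sign_complex A = {\<rho>. \<exists>s\<in>F. \<rho> \<subseteq> s \<or> \<rho> \<subseteq> flip_sign ` s}"
proof -
  obtain ss where ss: "set ss = F"
    using finite_list[OF fin] by blast
  define A where "A = mat_of_rows N (map (sign_row N) ss)"
  have dim: "dim_row A = length ss"
    by (simp add: A_def)
  have row: "row A k = sign_row N (ss ! k)" if "k < length ss" for k
    using that by (simp add: A_def sign_row_def)
  have plus: "row_simplex_plus (row A k) = ss ! k"
    and minus: "row_simplex_minus (row A k) = flip_sign ` (ss ! k)" if "k < length ss" for k
  proof -
    have "ss ! k \<in> F"
      using that ss by auto
    then show "row_simplex_plus (row A k) = ss ! k"
      and "row_simplex_minus (row A k) = flip_sign ` (ss ! k)"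
      using row_simplex_sign_row[of "ss ! k" N] bound opp by (simp_all add: row[OF that])
  qed
  have "sign_complex A =
      {\<rho>. \<exists>k<length ss. \<rho> \<subseteq> ss ! k \<or> \<rho> \<subseteq> flip_sign ` (ss ! k)}"
    using plus minus by (simp add: sign_complex_def dim cong: conj_cong)
  also have "\<dots> = {\<rho>. \<exists>s\<in>F. \<rho> \<subseteq> s \<or> \<rho> \<subseteq> flip_sign ` s}"
    unfolding ss[symmetric] set_conv_nth by blast
  finally show thesis
    by (rule that)
qed

text \<open>An enumeration \<open>e\<close> of \<open>V\<close> singles out one representative of each orbit, the vertex that comes
  first. Its position serves as the index of the orbit, and it receives the sign plus.\<close>

lemma ex_equivariant_labelling:
  fixes V :: "'a set" and \<tau> :: "'a \<Rightarrow> 'a"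
  assumes fin: "finite V"
    and inv: "\<And>v. v \<in> V \<Longrightarrow> \<tau> v \<in> V" "\<And>v. v \<in> V \<Longrightarrow> \<tau> (\<tau> v) = v"
    and free: "\<And>v. v \<in> V \<Longrightarrow> \<tau> v \<noteq> v"
  obtains \<phi> :: "'a \<Rightarrow> signed_index" and N
  where "inj_on \<phi> V" "\<And>v. v \<in> V \<Longrightarrow> \<phi> (\<tau> v) = flip_sign (\<phi> v)"
    "\<And>v. v \<in> V \<Longrightarrow> index_of (\<phi> v) < N"
proof -
  obtain e :: "'a \<Rightarrow> nat" where e: "bij_betw e V {0..<card V}"
    using ex_bij_betw_finite_nat[OF fin] by blast
  then have e_eq: "e u = e v \<longleftrightarrow> u = v" if "u \<in> V" "v \<in> V" for u v
    using that by (auto simp: bij_betw_def inj_on_def)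
  have e_less: "e v < card V" if "v \<in> V" for v
    using bij_betwE[OF e] that by simp
  define \<phi> where "\<phi> v = (if e v < e (\<tau> v) then Pos (e v) else Neg (e (\<tau> v)))" for v
  show thesis
  proof
    show "inj_on \<phi> V"
    proof (rule inj_onI)
      fix u v assume uv: "u \<in> V" "v \<in> V" and eq: "\<phi> u = \<phi> v"
      have "e u = e v \<or> e (\<tau> u) = e (\<tau> v)"
        using eq by (simp add: \<phi>_def split: if_splits)
      then have "u = v \<or> \<tau> u = \<tau> v"
        using uv inv(1) by (simp add: e_eq)
      then show "u = v"
        using uv inv(2) by metis
    qed
    show "\<phi> (\<tau> v) = flip_sign (\<phi> v)" if v: "v \<in> V" for v
    proof -
      have "e v \<noteq> e (\<tau> v)"
        using v inv(1) free by (metis e_eq)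
      then show ?thesis
        using inv(2)[OF v] by (simp add: \<phi>_def)
    qed
    show "index_of (\<phi> v) < card V" if "v \<in> V" for v
      using that inv(1) e_less by (simp add: \<phi>_def)
  qed
qed

text \<open>Otherwise the face \<open>{v, \<tau> v}\<close> of \<open>\<sigma>\<close> would be a nonempty simplex with \<open>\<tau> \<sigma> = \<sigma>\<close>. In
  particular \<open>\<tau>\<close> fixes no vertex.\<close>

lemma free_Z2_complex_antipode_notin:
  assumes K: "free_Z2_complex K \<tau>" and "\<sigma> \<in> K" "v \<in> \<sigma>"
  shows "\<tau> v \<notin> \<sigma>"
proof
  assume "\<tau> v \<in> \<sigma>"
  then have "{v, \<tau> v} \<in> K"
    using assms by (simp add: free_Z2_complex_def simplicial_complex_def)
  moreover have "\<tau> (\<tau> v) = v"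
    using assms by (auto simp: free_Z2_complex_def)
  then have "\<tau> ` {v, \<tau> v} = {v, \<tau> v}"
    by auto
  ultimately show False
    using K by (auto simp: free_Z2_complex_def)
qed

theorem lemma15:
  fixes K :: "'a set set" and \<tau> :: "'a \<Rightarrow> 'a"
  assumes "free_Z2_complex K \<tau>" and "finite K"
  shows "\<exists>A :: partial_sign_matrix. isomorphic_complexes K (sign_complex A)"
proof -
  let ?V = "vertex_set K"
  have down: "\<rho> \<in> K" if "\<sigma> \<in> K" "\<rho> \<subseteq> \<sigma>" for \<rho> \<sigma>
    using assms(1) that by (auto simp: free_Z2_complex_def simplicial_complex_def)
  have tau_K: "\<tau> ` \<sigma> \<in> K" if "\<sigma> \<in> K" for \<sigma>
    using assms(1) that by (auto simp: free_Z2_complex_def simplicial_map_def)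
  have fin: "finite ?V"
    using assms by (auto simp: free_Z2_complex_def simplicial_complex_def)
  have tau_V: "\<tau> v \<in> ?V" if "v \<in> ?V" for v
    using that tau_K by blast
  have tau_tau: "\<tau> (\<tau> v) = v" if "v \<in> ?V" for v
    using assms(1) that by (auto simp: free_Z2_complex_def)
  have tau_free: "\<tau> v \<noteq> v" if "v \<in> ?V" for v
    using free_Z2_complex_antipode_notin[OF assms(1)] that by force
  obtain \<phi> :: "'a \<Rightarrow> signed_index" and N where inj: "inj_on \<phi> ?V"
    and equi: "\<And>v. v \<in> ?V \<Longrightarrow> \<phi> (\<tau> v) = flip_sign (\<phi> v)"
    and bound: "\<And>v. v \<in> ?V \<Longrightarrow> index_of (\<phi> v) < N"
    using ex_equivariant_labelling[of ?V \<tau>, OF fin tau_V tau_tau tau_free] by blast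
  have flip: "flip_sign ` \<phi> ` \<sigma> = \<phi> ` \<tau> ` \<sigma>" if "\<sigma> \<in> K" for \<sigma>
    unfolding image_image using that equi[symmetric] by (intro image_cong[OF refl]) blast
  have opp: "\<phi> ` \<sigma> \<inter> flip_sign ` \<phi> ` \<sigma> = {}" if "\<sigma> \<in> K" for \<sigma>
  proof -
    have "\<sigma> \<inter> \<tau> ` \<sigma> = {}"
      using free_Z2_complex_antipode_notin[OF assms(1) that] by blast
    then show ?thesis
      using inj_on_image_Int[OF inj, of \<sigma> "\<tau> ` \<sigma>"] that tau_K[OF that]
      by (simp add: flip Union_upper)
  qed
  obtain A where "sign_complex A =
      {\<rho>. \<exists>s \<in> (`) \<phi> ` K. \<rho> \<subseteq> s \<or> \<rho> \<subseteq> flip_sign ` s}"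
  proof (rule ex_sign_matrix_generated_by)
    show "finite ((`) \<phi> ` K)"
      using assms(2) by simp
    show "index_of x < N" if "s \<in> (`) \<phi> ` K" "x \<in> s" for s x
      using that bound by blast
    show "s \<inter> flip_sign ` s = {}" if "s \<in> (`) \<phi> ` K" for s
      using that opp by blast
  qed
  \<comment> \<open>As \<open>K\<close> is closed under \<open>\<tau>\<close>, the negative halves of the rows contribute no new simplices.\<close>
  then have A: "\<rho> \<in> sign_complex A \<longleftrightarrow> (\<exists>\<sigma>\<in>K. \<rho> \<subseteq> \<phi> ` \<sigma>)" for \<rho>
    using tau_K by (simp add: flip cong: bex_cong) blast
  have "vertex_set (sign_complex A) = \<phi> ` ?V"
  proof
    show "vertex_set (sign_complex A) \<subseteq> \<phi> ` ?V"
      using A by blast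
    show "\<phi> ` ?V \<subseteq> vertex_set (sign_complex A)"
      using A by blast
  qed
  then have "bij_betw \<phi> ?V (vertex_set (sign_complex A))"
    using inj by (simp add: bij_betw_def)
  moreover have "\<sigma> \<in> K \<longleftrightarrow> \<phi> ` \<sigma> \<in> sign_complex A" if "\<sigma> \<subseteq> ?V" for \<sigma>
  proof -
    have "\<phi> ` \<sigma> \<subseteq> \<phi> ` \<sigma>' \<longleftrightarrow> \<sigma> \<subseteq> \<sigma>'" if "\<sigma>' \<in> K" for \<sigma>'
      using inj_on_image_mem_iff[OF inj, of _ \<sigma>'] \<open>\<sigma> \<subseteq> ?V\<close> that by blast
    then show ?thesis
      using down by (auto simp: A)
  qed
  ultimately show ?thesis
    unfolding isomorphic_complexes_def by blast
qed

end
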